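(* Let $h,p,k$ be positive integers with $1\le p\le h$ and $k\ge2$, and let $G$ be the graph on $n=h+(k-1)p$ vertices whose vertex set is the disjoint union of a set $C$ of $h-p$ vertices and $k$ sets $P_1,\dots,P_k$ of $p$ vertices each, such that $C\cup P_j$ is a clique for every $j$ and there are no edges between $P_i$ and $P_j$ for $i\ne j$ (so $G$ is a union of $k$ cliques of order $h$ having a common clique of order $h-p$). Let $S(G)=J_n-I_n-2A(G)$ be the Seidel adjacency matrix of $G$ (equivalently, the adjacency matrix of the signed complete graph on $n$ vertices whose negative edges are exactly the edges of $G$). Then the eigenvalues of $S(G)$ (with multiplicity) are the roots of the polynomial $$F(\lambda)=(1-2p-\lambda)^{\frac{n-h}{p}-1}(1-\lambda)^{n-2-\frac{n-h}{p}}\,s(\lambda),$$ where $$s(\lambda)=-\lambda^3-(2h-n+2p-3)\lambda^2-\big(2h^2-2(h-1)n+2(h-2)p-4h+3\big)\lambda+2h^2-(2h-1)n-2(2h^2-2hn-h+1)p-2h+4(h-n)p^2+1 .$$ In particular, $S(G)$ has eigenvalue $1$ with multiplicity at least $n-h-\frac{n-h}{p}$, and eigenvalue $1-2p$ with multiplicity at least $\frac{n-h}{p}-1$.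
   Context: $A(G)$ is the $0/1$ adjacency matrix of $G$, $J_n$ the $n\times n$ all-ones matrix and $I_n$ the identity matrix. Note $\frac{n-h}{p}=k-1$. *)

theory Defs
  imports "Jordan_Normal_Form.Char_Poly" Complex_Main
begin

definition simple_graph :: "'v set \<Rightarrow> 'v set set \<Rightarrow> bool" where
  "simple_graph V E \<longleftrightarrow> finite V \<and> (\<forall>e\<in>E. e \<subseteq> V \<and> card e = 2)"

definition is_clique :: "'v set set \<Rightarrow> 'v set \<Rightarrow> bool" where
  "is_clique E X \<longleftrightarrow> (\<forall>u\<in>X. \<forall>v\<in>X. u \<noteq> v \<longrightarrow> {u, v} \<in> E)"

text \<open>The rows and columns are indexed by the vertices in the order given by the list \<open>vs\<close>,
  which is meant to enumerate the vertex set without repetition.\<close>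

definition adjacency_matrix :: "'v list \<Rightarrow> 'v set set \<Rightarrow> 'a::comm_ring_1 mat" where
  "adjacency_matrix vs E =
     mat (length vs) (length vs) (\<lambda>(i, j). if {vs ! i, vs ! j} \<in> E then 1 else 0)"

definition all_ones_matrix :: "nat \<Rightarrow> 'a::comm_ring_1 mat" where
  "all_ones_matrix n = mat n n (\<lambda>_. 1)"

definition seidel_matrix :: "'v list \<Rightarrow> 'v set set \<Rightarrow> 'a::comm_ring_1 mat" where
  "seidel_matrix vs E =
     all_ones_matrix (length vs) - 1\<^sub>m (length vs) - 2 \<cdot>\<^sub>m adjacency_matrix vs E"

text \<open>The multiset of complex eigenvalues, each counted with its algebraic multiplicity.\<close>

definition eigenvalue_mset :: "complex mat \<Rightarrow> complex multiset" where
  "eigenvalue_mset A = proots (char_poly A)"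

definition cubic_factor :: "complex \<Rightarrow> complex \<Rightarrow> complex \<Rightarrow> complex \<Rightarrow> complex" where
  "cubic_factor h n p x =
     - (x ^ 3) - (2 * h - n + 2 * p - 3) * x ^ 2
     - (2 * h ^ 2 - 2 * (h - 1) * n + 2 * (h - 2) * p - 4 * h + 3) * x
     + 2 * h ^ 2 - (2 * h - 1) * n - 2 * (2 * h ^ 2 - 2 * h * n - h + 1) * p
     - 2 * h + 4 * (h - n) * p ^ 2 + 1"

text \<open>\<open>F\<close> is the polynomial
  \<open>(1 - 2p - x)^((n-h)/p - 1) (1 - x)^(n - 2 - (n-h)/p) s(x)\<close>.
  For \<open>h = p = 1\<close> the second exponent is \<open>-1\<close> (the cubic is then divisible by \<open>1 - x\<close>),
  so the exponent is an integer and the identity is required away from \<open>x = 1\<close>;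
  this determines \<open>F\<close> uniquely. The division by \<open>p\<close> is exact for \<open>n = h + (k - 1) p\<close>.\<close>

definition is_seidel_F :: "nat \<Rightarrow> nat \<Rightarrow> nat \<Rightarrow> complex poly \<Rightarrow> bool" where
  "is_seidel_F h n p F \<longleftrightarrow>
     (\<forall>x. x \<noteq> 1 \<longrightarrow>
        poly F x =
          (1 - 2 * of_nat p - x) powi (int ((n - h) div p) - 1)
          * (1 - x) powi (int n - 2 - int ((n - h) div p))
          * cubic_factor (of_nat h) (of_nat n) (of_nat p) x)"

end

theory Submission
  imports Defs
begin

text \<open>Off the diagonal, an entry of \<open>S(G)\<close> depends only on the blocks (\<open>C\<close> or some \<open>P\<^sub>j\<close>) of its
  row and column, and \<open>S(G) - I\<close> extends this to the diagonal. So \<open>S(G) - I = U W\<close>, where \<open>U\<close> has one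
  column per block, and \<open>x\<^sup>m det (x I - U W) = x\<^sup>n det (x I - W U)\<close> trades \<open>S(G) - I\<close> for a matrix \<open>T\<close>
  of size \<open>k + 1\<close>. In \<open>T + 2 p I\<close> the rows of all \<open>P\<^sub>j\<close> coincide, so the same identity trades it for a
  \<open>2 \<times> 2\<close> matrix, whose characteristic polynomial divides the cubic.\<close>

section \<open>Characteristic polynomials of products\<close>

lemma det_smult_one_minus_mult_comm:
  fixes x :: "'a::idom"
  assumes A: "A \<in> carrier_mat n m" and B: "B \<in> carrier_mat m n"
  shows "x ^ m * det (x \<cdot>\<^sub>m 1\<^sub>m n - A * B) = x ^ n * det (x \<cdot>\<^sub>m 1\<^sub>m m - B * A)"
proof -
  define M where "M = four_block_mat (x \<cdot>\<^sub>m 1\<^sub>m n) A B (1\<^sub>m m)"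
  define L where "L = four_block_mat (1\<^sub>m n) (0\<^sub>m n m) (- B) (1\<^sub>m m)"
  define R where "R = four_block_mat (1\<^sub>m n) (- A) (0\<^sub>m m n) (x \<cdot>\<^sub>m 1\<^sub>m m)"
  have AB: "A * B \<in> carrier_mat n n" and BA: "B * A \<in> carrier_mat m m"
    using A B by auto
  have carrier: "M \<in> carrier_mat (n + m) (n + m)" "L \<in> carrier_mat (n + m) (n + m)"
    "R \<in> carrier_mat (n + m) (n + m)"
    using A B by (auto simp: M_def L_def R_def)
  have "M * L = four_block_mat (x \<cdot>\<^sub>m 1\<^sub>m n - A * B) A (0\<^sub>m m n) (1\<^sub>m m)"
    unfolding M_def L_def using A B
    by (subst mult_four_block_mat[of _ n n _ m _ m]) (auto intro!: cong_four_block_mat)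
  hence "det (M * L) = det (x \<cdot>\<^sub>m 1\<^sub>m n - A * B)"
    using A AB by (simp add: det_four_block_mat_lower_left_zero[of _ n _ m] minus_carrier_mat)
  moreover have "det L = 1"
    unfolding L_def using B by (subst det_four_block_mat_upper_right_zero[of _ n _ m]) auto
  moreover have "(x \<cdot>\<^sub>m 1\<^sub>m n) * (- A) + A * (x \<cdot>\<^sub>m 1\<^sub>m m) = 0\<^sub>m n m"
    using A by (simp add: mult_smult_distrib[of _ n m _ m] mult_smult_assoc_mat[of _ n n _ m])
  hence "M * R = four_block_mat (x \<cdot>\<^sub>m 1\<^sub>m n) (0\<^sub>m n m) B (x \<cdot>\<^sub>m 1\<^sub>m m - B * A)"
    unfolding M_def R_def using A B BA
    by (subst mult_four_block_mat[of _ n n _ m _ m]) (auto intro!: cong_four_block_mat)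
  hence "det (M * R) = x ^ n * det (x \<cdot>\<^sub>m 1\<^sub>m m - B * A)"
    using B BA by (simp add: det_four_block_mat_upper_right_zero[of _ n _ m] minus_carrier_mat)
  moreover have "det R = x ^ m"
    unfolding R_def using A by (subst det_four_block_mat_lower_left_zero[of _ n _ m]) auto
  ultimately show ?thesis
    using det_mult[OF carrier(1,2)] det_mult[OF carrier(1,3)] by (simp add: mult.commute)
qed

lemma char_poly_smult_one_plus:
  assumes "A \<in> carrier_mat n n"
  shows "char_poly (a \<cdot>\<^sub>m 1\<^sub>m n + A) = det ([:- a, 1:] \<cdot>\<^sub>m 1\<^sub>m n - map_mat (\<lambda>c. [:c:]) A)"
proof -
  have "char_poly_matrix (a \<cdot>\<^sub>m 1\<^sub>m n + A) = [:- a, 1:] \<cdot>\<^sub>m 1\<^sub>m n - map_mat (\<lambda>c. [:c:]) A"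
    using assms by (intro eq_matI) (auto simp: char_poly_matrix_def)
  thus ?thesis
    by (simp add: char_poly_def)
qed

lemma char_poly_smult_one_plus_mult_comm:
  fixes a :: "'a::idom"
  assumes "A \<in> carrier_mat n m" and "B \<in> carrier_mat m n"
  shows "[:- a, 1:] ^ m * char_poly (a \<cdot>\<^sub>m 1\<^sub>m n + A * B) =
    [:- a, 1:] ^ n * char_poly (a \<cdot>\<^sub>m 1\<^sub>m m + B * A)"
  using assms
  by (simp add: char_poly_smult_one_plus[of _ n] char_poly_smult_one_plus[of _ m]
      map_poly_mult(1)[of _ n m] map_poly_mult(1)[of _ m n] det_smult_one_minus_mult_comm)

lemma char_poly_block_rows:
  fixes a :: "'a::idom" and B :: "nat \<Rightarrow> nat \<Rightarrow> 'a"
  assumes b: "\<And>i. i < n \<Longrightarrow> b i < m"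
  shows "[:- a, 1:] ^ m * char_poly (a \<cdot>\<^sub>m 1\<^sub>m n + mat n n (\<lambda>(i, j). B (b i) j)) =
    [:- a, 1:] ^ n * char_poly (a \<cdot>\<^sub>m 1\<^sub>m m + mat m m (\<lambda>(l, r). \<Sum>j | j < n \<and> b j = r. B l j))"
proof -
  define U where "U = mat n m (\<lambda>(i, l). of_bool (b i = l) :: 'a)"
  define W where "W = mat m n (\<lambda>(l, j). B l j)"
  have "U * W = mat n n (\<lambda>(i, j). B (b i) j)"
    using b by (intro eq_matI) (auto simp: U_def W_def scalar_prod_def of_bool_def
        if_distrib[of "\<lambda>x. x * _"] cong: if_cong)
  moreover have "W * U = mat m m (\<lambda>(l, r). \<Sum>j | j < n \<and> b j = r. B l j)"
    by (intro eq_matI)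
      (auto simp: U_def W_def scalar_prod_def intro!: sum.mono_neutral_cong_right)
  ultimately show ?thesis
    using char_poly_smult_one_plus_mult_comm[of U n m W a] by (simp add: U_def W_def)
qed

lemma det_dim_two:
  assumes A: "A \<in> carrier_mat 2 2"
  shows "det A = A $$ (0, 0) * A $$ (1, 1) - A $$ (0, 1) * A $$ (1, 0)"
proof -
  have "det A = (\<Sum>j<2. A $$ (0, j) * cofactor A 0 j)"
    by (rule laplace_expansion_row[OF A]) simp
  thus ?thesis
    using A by (simp add: numeral_2_eq_2 cofactor_def det_single mat_delete_def)
qed

lemma poly_char_poly_dim_two:
  assumes "A \<in> carrier_mat 2 2"
  shows "poly (char_poly A) x =
    (x - A $$ (0, 0)) * (x - A $$ (1, 1)) - A $$ (0, 1) * A $$ (1, 0)"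
  using assms by (simp add: char_poly_def det_dim_two char_poly_matrix_def algebra_simps)

lemma char_poly_neq_0:
  "A \<in> carrier_mat n n \<Longrightarrow> char_poly A \<noteq> 0"
  using degree_monic_char_poly[of A n] by auto

section \<open>The quotient matrices\<close>

text \<open>Block 0 is the common clique \<open>C\<close>, block \<open>j > 0\<close> is \<open>P\<^sub>j\<close>; the values are the entries of
  \<open>S(G) - I\<close>.\<close>

definition block_sign :: "nat \<Rightarrow> nat \<Rightarrow> 'a::comm_ring_1" where
  "block_sign l r = (if l = 0 \<or> r = 0 \<or> l = r then - 1 else 1)"

definition block_quotient :: "'a \<Rightarrow> 'a \<Rightarrow> nat \<Rightarrow> 'a::comm_ring_1 mat" where
  "block_quotient c p k = 1 \<cdot>\<^sub>m 1\<^sub>m (Suc k) +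
    mat (Suc k) (Suc k) (\<lambda>(l, r). block_sign l r * (if r = 0 then c else p))"

definition core_petal_quotient :: "'a \<Rightarrow> 'a \<Rightarrow> nat \<Rightarrow> 'a::comm_ring_1 mat" where
  "core_petal_quotient c p k =
    mat_of_rows_list 2 [[1 - c, - (of_nat k * p)], [- c, 1 - 2 * p + of_nat k * p]]"

lemma core_petal_quotient_carrier [simp]: "core_petal_quotient c p k \<in> carrier_mat 2 2"
  by (rule carrier_matI) (simp_all add: core_petal_quotient_def mat_of_rows_list_def)

lemma poly_char_poly_core_petal_quotient:
  "poly (char_poly (core_petal_quotient c p k)) x =
    (x - 1 + c) * (x - 1 + 2 * p - of_nat k * p) - of_nat k * p * c"
  unfolding poly_char_poly_dim_two[OF core_petal_quotient_carrier]
  by (simp add: core_petal_quotient_def mat_of_rows_list_def algebra_simps)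

lemma cubic_factor_eq_core_petal_quotient:
  "cubic_factor (c + p) (c + of_nat k * p) p x =
    (1 - 2 * p - x) * poly (char_poly (core_petal_quotient c p k)) x"
  unfolding cubic_factor_def poly_char_poly_core_petal_quotient
  by (simp add: algebra_simps power2_eq_square power3_eq_cube)

lemma char_poly_block_quotient:
  fixes c p :: "'a::idom"
  assumes k: "0 < k"
  shows "char_poly (block_quotient c p k) =
    [:2 * p - 1, 1:] ^ (k - 1) * char_poly (core_petal_quotient c p k)"
proof -
  define a where "a = 1 - 2 * p"
  define B where "B l r = (if r = 0 then if l = 0 then 2 * p - c else - c
    else if l = 0 then - p else p)" for l r :: nat
  have rows: "block_quotient c p k =
      a \<cdot>\<^sub>m 1\<^sub>m (Suc k) + mat (Suc k) (Suc k) (\<lambda>(l, r). B (min 1 l) r)"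
    by (intro eq_matI) (auto simp: block_quotient_def block_sign_def a_def B_def)
  have "{j. j < Suc k \<and> min 1 j = 0} = {0}"
    by auto
  hence core: "(\<Sum>j | j < Suc k \<and> min 1 j = 0. B l j) = B l 0" for l
    by simp
  have "{j. j < Suc k \<and> min 1 j = 1} = {1..k}"
    by auto
  hence petals: "(\<Sum>j | j < Suc k \<and> min 1 j = 1. B l j) = of_nat k * B l 1" for l
    by (simp add: B_def)
  have quotient: "core_petal_quotient c p k =
      a \<cdot>\<^sub>m 1\<^sub>m 2 + mat 2 2 (\<lambda>(l, r). \<Sum>j | j < Suc k \<and> min 1 j = r. B l j)" (is "_ = ?Q")
  proof (rule eq_matI)
    fix l r assume "l < dim_row ?Q" and "r < dim_col ?Q"
    hence "l \<in> {0, 1}" and "r \<in> {0, 1}"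
      by auto
    thus "core_petal_quotient c p k $$ (l, r) = ?Q $$ (l, r)"
      using core petals
      by (auto simp: core_petal_quotient_def mat_of_rows_list_def a_def B_def)
  qed (simp_all add: core_petal_quotient_def mat_of_rows_list_def)
  have "[:- a, 1:] ^ 2 * char_poly (block_quotient c p k) =
      [:- a, 1:] ^ Suc k * char_poly (core_petal_quotient c p k)"
    unfolding rows quotient by (rule char_poly_block_rows) simp
  also have "Suc k = 2 + (k - 1)"
    using k by simp
  finally have "[:- a, 1:] ^ 2 * char_poly (block_quotient c p k) =
      [:- a, 1:] ^ 2 * ([:- a, 1:] ^ (k - 1) * char_poly (core_petal_quotient c p k))"
    by (simp only: power_add mult.assoc)
  thus ?thesis
    by (subst (asm) mult_cancel_left) (simp add: a_def)
qed

section \<open>Sunflowers of cliques\<close>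

locale clique_sunflower =
  fixes V :: "'v set" and E :: "'v set set" and C :: "'v set" and P :: "nat \<Rightarrow> 'v set"
    and k p :: nat
  assumes simple: "simple_graph V E"
    and vertices: "V = C \<union> (\<Union>j\<in>{1..k}. P j)"
    and core_petal_disjoint: "\<And>j. j \<in> {1..k} \<Longrightarrow> C \<inter> P j = {}"
    and petals_disjoint: "\<And>i j. i \<in> {1..k} \<Longrightarrow> j \<in> {1..k} \<Longrightarrow> i \<noteq> j \<Longrightarrow> P i \<inter> P j = {}"
    and card_petal: "\<And>j. j \<in> {1..k} \<Longrightarrow> card (P j) = p"
    and clique: "\<And>j. j \<in> {1..k} \<Longrightarrow> is_clique E (C \<union> P j)"
    and petals_nonadjacent: "\<And>i j u v. i \<in> {1..k} \<Longrightarrow> j \<in> {1..k} \<Longrightarrow> i \<noteq> j \<Longrightarrow>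
      u \<in> P i \<Longrightarrow> v \<in> P j \<Longrightarrow> {u, v} \<notin> E"
    and petal_number_pos: "0 < k"
begin

definition part :: "nat \<Rightarrow> 'v set" where
  "part j = (if j = 0 then C else P j)"

definition block :: "'v \<Rightarrow> nat" where
  "block v = (THE j. j \<le> k \<and> v \<in> part j)"

lemma part_Int_empty: "i \<le> k \<Longrightarrow> j \<le> k \<Longrightarrow> i \<noteq> j \<Longrightarrow> part i \<inter> part j = {}"
  using core_petal_disjoint[of i] core_petal_disjoint[of j] petals_disjoint[of i j]
  by (auto simp: part_def)

lemma vertices_eq_UN_part: "V = (\<Union>j\<le>k. part j)"
  by (force simp: vertices part_def split: if_splits)

lemma card_part: "r \<le> k \<Longrightarrow> card (part r) = (if r = 0 then card C else p)"
  by (simp add: part_def card_petal)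

lemma block_eqI: "j \<le> k \<Longrightarrow> v \<in> part j \<Longrightarrow> block v = j"
  unfolding block_def using part_Int_empty by (intro the_equality) blast+

lemma block_le: "v \<in> V \<Longrightarrow> block v \<le> k"
  and mem_part_block: "v \<in> V \<Longrightarrow> v \<in> part (block v)"
  using block_eqI by (auto simp: vertices_eq_UN_part)

lemma vertices_in_block: "r \<le> k \<Longrightarrow> {v \<in> V. block v = r} = part r"
  using block_eqI mem_part_block by (auto simp: vertices_eq_UN_part)

lemma card_vertices: "card V = card C + k * p"
proof -
  have "finite (part j)" if "j \<le> k" for j
    using simple that by (auto simp: simple_graph_def vertices_eq_UN_part)
  hence "card V = (\<Sum>j\<le>k. card (part j))"
    unfolding vertices_eq_UN_part using part_Int_empty by (intro card_UN_disjoint) simp_all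
  also have "\<dots> = (\<Sum>j\<le>k. if j = 0 then card C else p)"
    by (simp add: card_part)
  also have "\<dots> = card C + k * p"
    by (simp add: sum.atMost_shift)
  finally show ?thesis .
qed

lemma edge_iff_block:
  assumes "u \<in> V" and "v \<in> V"
  shows "{u, v} \<in> E \<longleftrightarrow> u \<noteq> v \<and> (block u = 0 \<or> block v = 0 \<or> block u = block v)"
proof (intro iffI conjI)
  assume edge: "{u, v} \<in> E"
  thus "u \<noteq> v"
    using simple by (auto simp: simple_graph_def)
  show "block u = 0 \<or> block v = 0 \<or> block u = block v"
    using edge assms petals_nonadjacent[of "block u" "block v" u v]
      block_le mem_part_block[of u] mem_part_block[of v]
    by (auto simp: part_def Suc_le_eq split: if_splits)
next
  assume adj: "u \<noteq> v \<and> (block u = 0 \<or> block v = 0 \<or> block u = block v)"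
  define j where "j = max 1 (max (block u) (block v))"
  have "j \<in> {1..k}"
    using assms block_le petal_number_pos by (simp add: j_def Suc_le_eq)
  moreover have "{u, v} \<subseteq> C \<union> P j"
    using adj assms mem_part_block[of u] mem_part_block[of v]
    by (auto simp: part_def j_def max_def split: if_splits)
  ultimately show "{u, v} \<in> E"
    using adj clique[of j] by (simp add: is_clique_def)
qed

context
  fixes vs :: "'v list"
  assumes enumeration: "distinct vs" "set vs = V"
begin

lemma length_enumeration: "length vs = card V"
  using enumeration by (metis distinct_card)

lemma seidel_matrix_eq_block_sign:
  "seidel_matrix vs E = 1 \<cdot>\<^sub>m 1\<^sub>m (length vs) +
    mat (length vs) (length vs) (\<lambda>(i, j). block_sign (block (vs ! i)) (block (vs ! j)))"
    (is "?S = ?T")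
proof (rule eq_matI)
  fix i j assume "i < dim_row ?T" and "j < dim_col ?T"
  hence ij: "i < length vs" "j < length vs"
    by simp_all
  hence "vs ! i = vs ! j \<longleftrightarrow> i = j"
    using enumeration by (simp add: nth_eq_iff_index_eq)
  moreover have "vs ! i \<in> V" "vs ! j \<in> V"
    using ij enumeration nth_mem by blast+
  ultimately show "?S $$ (i, j) = ?T $$ (i, j)"
    using ij by (auto simp: edge_iff_block seidel_matrix_def all_ones_matrix_def
        adjacency_matrix_def block_sign_def)
qed (simp_all add: seidel_matrix_def adjacency_matrix_def)

lemma card_indices_in_block:
  assumes "r \<le> k"
  shows "card {i. i < length vs \<and> block (vs ! i) = r} = (if r = 0 then card C else p)"
proof -
  have "card {i. i < length vs \<and> block (vs ! i) = r} = length (filter (\<lambda>v. block v = r) vs)"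
    by (simp add: length_filter_conv_card)
  also have "\<dots> = card {v \<in> V. block v = r}"
    using enumeration distinct_card[of "filter (\<lambda>v. block v = r) vs"] by simp
  finally show ?thesis
    by (simp add: assms vertices_in_block card_part)
qed

theorem char_poly_seidel_matrix:
  "[:- 1, 1:] ^ Suc k * char_poly (seidel_matrix vs E) = [:- 1, 1:] ^ card V *
    ([:2 * of_nat p - 1, 1:] ^ (k - 1) *
     char_poly (core_petal_quotient (of_nat (card C)) (of_nat p) k :: 'a::idom mat))"
proof -
  have quotient: "block_quotient (of_nat (card C)) (of_nat p :: 'a) k =
      1 \<cdot>\<^sub>m 1\<^sub>m (Suc k) + mat (Suc k) (Suc k)
        (\<lambda>(l, r). \<Sum>j | j < length vs \<and> block (vs ! j) = r. block_sign l (block (vs ! j)))"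
    by (intro eq_matI) (auto simp: block_quotient_def card_indices_in_block)
  have "[:- 1, 1:] ^ Suc k * char_poly (seidel_matrix vs E) =
      [:- 1, 1:] ^ length vs * char_poly (block_quotient (of_nat (card C)) (of_nat p :: 'a) k)"
    unfolding seidel_matrix_eq_block_sign quotient
    using enumeration block_le by (intro char_poly_block_rows) (auto simp: less_Suc_eq_le)
  thus ?thesis
    using petal_number_pos by (simp add: char_poly_block_quotient length_enumeration)
qed

lemma seidel_matrix_carrier: "seidel_matrix vs E \<in> carrier_mat (card V) (card V)"
  by (simp add: seidel_matrix_eq_block_sign length_enumeration)

theorem eigenvalue_mset_seidel_matrix:
  "replicate_mset (Suc k) 1 + eigenvalue_mset (seidel_matrix vs E) =
    replicate_mset (card V) 1 + replicate_mset (k - 1) (1 - 2 * of_nat p) +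
    eigenvalue_mset (core_petal_quotient (of_nat (card C)) (of_nat p) k)"
  using arg_cong[OF char_poly_seidel_matrix, of proots, where 'a2 = complex]
  by (simp add: eigenvalue_mset_def proots_mult proots_power seidel_matrix_carrier
      char_poly_neq_0[of _ 2] char_poly_neq_0[of _ "card V"] del: power_Suc)

corollary count_eigenvalue_one:
  "card V - Suc k \<le> count (eigenvalue_mset (seidel_matrix vs E)) 1"
  using arg_cong[OF eigenvalue_mset_seidel_matrix, of "\<lambda>M. count M 1"] by simp

corollary count_eigenvalue_one_minus_twice_petal:
  assumes "0 < p"
  shows "k - 1 \<le> count (eigenvalue_mset (seidel_matrix vs E)) (1 - 2 * of_nat p)"
  using arg_cong[OF eigenvalue_mset_seidel_matrix, of "\<lambda>M. count M (1 - 2 * of_nat p)"] assms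
  by simp

theorem is_seidel_F_char_poly:
  assumes "2 \<le> k" and "0 < p"
  shows "is_seidel_F (card C + p) (card V) p
    (Polynomial.smult ((- 1) ^ card V) (char_poly (seidel_matrix vs E)))"
    (is "is_seidel_F _ _ _ ?F")
  unfolding is_seidel_F_def
proof (intro allI impI)
  fix x :: complex
  assume "x \<noteq> 1"
  define y where "y = 1 - x"
  define z where "z = 1 - 2 * of_nat p - x"
  define \<chi> where "\<chi> = poly (char_poly (seidel_matrix vs E)) x"
  define q where "q = poly (char_poly (core_petal_quotient (of_nat (card C)) (of_nat p) k)) x"
  have y: "y \<noteq> 0"
    using \<open>x \<noteq> 1\<close> by (simp add: y_def)
  obtain m where k: "k = Suc (Suc m)"
    using le_Suc_ex[OF assms(1)] by auto
  have quotient: "(card V - (card C + p)) div p = Suc m"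
    using assms(2) by (simp add: card_vertices k)
  have "(- y) ^ Suc k * \<chi> = (- y) ^ card V * ((- z) ^ (k - 1) * q)"
    using arg_cong[OF char_poly_seidel_matrix, of "\<lambda>f. poly f x"]
    by (simp add: y_def z_def \<chi>_def q_def algebra_simps del: power_Suc)
  hence "y ^ Suc k * \<chi> = (- 1) ^ card V * (y ^ card V * (z ^ (k - 1) * q))"
    by (simp add: power_minus[of y] power_minus[of z] k mult.assoc)
  hence "(- 1) ^ card V * (y ^ Suc k * \<chi>) = y ^ card V * (z ^ (k - 1) * q)"
    by simp
  hence "(- 1) ^ card V * \<chi> = y ^ card V / y ^ Suc k * (z ^ (k - 1) * q)"
    using y by (simp add: field_simps)
  also have "y ^ card V / y ^ Suc k = y powi (int (card V) - int (Suc k))"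
    by (simp only: power_int_diff[OF disjI1[OF y]] power_int_of_nat)
  also have "\<dots> * (z ^ (k - 1) * q) =
      z powi (int (Suc m) - 1) * y powi (int (card V) - 2 - int (Suc m)) * (z * q)"
    by (simp add: k algebra_simps)
  also have "z * q = cubic_factor (of_nat (card C + p)) (of_nat (card V)) (of_nat p) x"
    using cubic_factor_eq_core_petal_quotient[of "of_nat (card C)" "of_nat p" k x]
    by (simp add: card_vertices z_def q_def)
  finally show "poly ?F x =
      (1 - 2 * of_nat p - x) powi (int ((card V - (card C + p)) div p) - 1) *
      (1 - x) powi (int (card V) - 2 - int ((card V - (card C + p)) div p)) *
      cubic_factor (of_nat (card C + p)) (of_nat (card V)) (of_nat p) x"
    by (simp add: quotient y_def z_def \<chi>_def)
qed

end

end

theorem theorem2: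
  fixes h p k n :: nat
    and V C :: "'v set" and P :: "nat \<Rightarrow> 'v set" and E :: "'v set set" and vs :: "'v list"
    and S :: "complex mat"
  assumes "1 \<le> p" and "p \<le> h" and "2 \<le> k"
    and "n = h + (k - 1) * p"
    and "simple_graph V E"
    and "V = C \<union> (\<Union>j\<in>{1..k}. P j)"
    and "\<forall>j\<in>{1..k}. C \<inter> P j = {}"
    and "\<forall>i\<in>{1..k}. \<forall>j\<in>{1..k}. i \<noteq> j \<longrightarrow> P i \<inter> P j = {}"
    and "card C = h - p"
    and "\<forall>j\<in>{1..k}. card (P j) = p"
    and "\<forall>j\<in>{1..k}. is_clique E (C \<union> P j)"
    and "\<forall>i\<in>{1..k}. \<forall>j\<in>{1..k}. i \<noteq> j \<longrightarrow> (\<forall>u\<in>P i. \<forall>v\<in>P j. {u, v} \<notin> E)"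
    and "distinct vs" and "set vs = V"
    and "S = seidel_matrix vs E"
  shows "(\<exists>F. is_seidel_F h n p F \<and> eigenvalue_mset S = proots F)
    \<and> count (eigenvalue_mset S) 1 \<ge> n - h - (n - h) div p
    \<and> count (eigenvalue_mset S) (1 - 2 * of_nat p) \<ge> (n - h) div p - 1"
proof -
  interpret clique_sunflower V E C P k p
    using assms by unfold_locales auto
  have h: "h = card C + p"
    using assms(2,9) by simp
  have n: "n = card V"
    using assms(3,4) by (cases k) (simp_all add: card_vertices h)
  have petals: "(n - h) div p = k - 1"
    using assms(1,4) by simp
  define F where "F = Polynomial.smult ((- 1) ^ card V) (char_poly S)"
  have "is_seidel_F h n p F"
    unfolding F_def h n assms(15) using assms(1,3,13,14) by (intro is_seidel_F_char_poly) simp_all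
  moreover have "eigenvalue_mset S = proots F"
    by (simp add: F_def eigenvalue_mset_def)
  moreover have "n - h - (k - 1) \<le> n - Suc k"
    using assms(1-4) by (cases "h = 1") auto
  hence "n - h - (k - 1) \<le> count (eigenvalue_mset S) 1"
    unfolding n assms(15) using count_eigenvalue_one[OF assms(13,14)] by (rule le_trans)
  moreover have "k - 1 \<le> count (eigenvalue_mset S) (1 - 2 * of_nat p)"
    using assms(1,13-15) count_eigenvalue_one_minus_twice_petal by simp
  ultimately show ?thesis
    unfolding petals by auto
qed

end
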